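(* Let $\mathbb{K}$ be a field, $q\in\mathbb{K}^\times$, let $Q$ be a skew-symmetric integral $n\times n$ matrix, and let $$\mathbb{T}^n(Q)=\frac{\mathbb{K}\langle x_1^{\pm1},\dots,x_n^{\pm1}\rangle}{(x_ix_j=q^{Q_{i,j}}x_jx_i)}$$ be the quantum torus on $n$ generators. Let $k\ge 1$ be the number of non-central generators of $\mathbb{T}^n(Q)$ and suppose $q^{Q_{i,j}/2}\in\mathbb{K}$ for all $i,j$. Then the commutative ring $\mathbb{K}[y_1^{\pm1},\dots,y_{k-1}^{\pm1}]$ has a well-defined $\mathbb{T}^n(Q)$-module structure. In particular, if the non-central generators are the first $k$ generators $x_1,\dots,x_k$, then for $i\in\{1,\dots,k-1\}$ and $m\in\{k+1,\dots,n\}$ the operators \begin{align*} x_i\cdot f(y_1,\dots,y_{k-1})&:=y_i\,f(q^{Q_{i,1}/2}y_1,\,q^{Q_{i,2}/2}y_2,\dots,q^{Q_{i,k-1}/2}y_{k-1}),\\ x_k\cdot f(y_1,\dots,y_{k-1})&:=f(q^{Q_{k,1}}y_1,\,q^{Q_{k,2}}y_2,\dots,q^{Q_{k,k-1}}y_{k-1}),\\ x_m\cdot f(y_1,\dots,y_{k-1})&:=f(y_1,\dots,y_{k-1}) \end{align*} define a $\mathbb{T}^n(Q)$-module structure on $\mathbb{K}[y_1^{\pm1},\dots,y_{k-1}^{\pm1}]$.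
   Context: Here $q^{a/2}$ for an integer $a$ means $(q^{1/2})^a$ for a fixed square root $q^{1/2}$ of $q$ (in an extension of $\mathbb{K}$ if necessary), so in particular $q^{Q_{j,i}/2}=(q^{Q_{i,j}/2})^{-1}$. A generator $x_i$ is central if it commutes with all generators. The algebra $\mathbb{T}^n(Q)$ is associative and unital, with each $x_i$ invertible. *)

theory Defs
  imports "HOL-Algebra.Algebra" "HOL-Library.Poly_Mapping"
begin

text \<open>
  The free monoid on \<open>'g\<close>, written additively: multiplication in the type
  \<open>'m \<Rightarrow>\<^sub>0 'k\<close> is convolution along \<open>+\<close>, so \<open>'g word \<Rightarrow>\<^sub>0 'k\<close> is the free associative
  unital \<open>'k\<close>-algebra on \<open>'g\<close>.
\<close>

datatype 'g word = Word (letters: "'g list")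

instantiation word :: (type) monoid_add
begin

definition zero_word :: "'a word" where
  "0 = Word []"

definition plus_word :: "'a word \<Rightarrow> 'a word \<Rightarrow> 'a word" where
  "u + v = Word (letters u @ letters v)"

instance
  by standard (simp_all add: zero_word_def plus_word_def)

end

datatype letter = Gen nat | Inv nat

type_synonym 'k free_elt = "letter word \<Rightarrow>\<^sub>0 'k"

text \<open>The ring structure that a subset inherits from a type-class ring.\<close>

definition ring_on :: "'a::ring_1 set \<Rightarrow> 'a ring" where
  "ring_on A = \<lparr>carrier = A, monoid.mult = (*), one = 1, ring.zero = 0, add = (+)\<rparr>"

definition free_alg :: "nat \<Rightarrow> ('k::field) free_elt ring" where
  "free_alg n =
    ring_on {p. \<forall>w\<in>Poly_Mapping.keys p. set (letters w) \<subseteq> Gen ` {1..n} \<union> Inv ` {1..n}}"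

definition letter_elt :: "letter \<Rightarrow> ('k::field) free_elt" where
  "letter_elt l = Poly_Mapping.single (Word [l]) 1"

definition const_elt :: "'k::field \<Rightarrow> 'k free_elt" where
  "const_elt c = Poly_Mapping.single 0 c"

text \<open>
  The relations \<open>x\<^sub>i x\<^sub>i\<inverse> = 1 = x\<^sub>i\<inverse> x\<^sub>i\<close>, which cut out \<open>K\<langle>x\<^sub>1\<^sup>\<plusminus>\<^sup>1, \<dots>, x\<^sub>n\<^sup>\<plusminus>\<^sup>1\<rangle>\<close>, together with
  \<open>x\<^sub>i x\<^sub>j = q\<^bsup>Q i j\<^esup> x\<^sub>j x\<^sub>i\<close>; they are imposed in one step on the free algebra on the
  letters \<open>x\<^sub>i\<close>, \<open>x\<^sub>i\<inverse>\<close>.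
\<close>

definition torus_relations ::
    "'k::field \<Rightarrow> nat \<Rightarrow> (nat \<Rightarrow> nat \<Rightarrow> int) \<Rightarrow> 'k free_elt set" where
  "torus_relations q n Q =
     (\<Union>i\<in>{1..n}. {letter_elt (Gen i) * letter_elt (Inv i) - 1,
                   letter_elt (Inv i) * letter_elt (Gen i) - 1}) \<union>
     (\<Union>i\<in>{1..n}. \<Union>j\<in>{1..n}.
        {letter_elt (Gen i) * letter_elt (Gen j)
          - const_elt (q powi Q i j) * (letter_elt (Gen j) * letter_elt (Gen i))})"

text \<open>\<^const>\<open>genideal\<close> is the two-sided ideal generated by a set.\<close>

definition torus_ideal ::
    "'k::field \<Rightarrow> nat \<Rightarrow> (nat \<Rightarrow> nat \<Rightarrow> int) \<Rightarrow> 'k free_elt set" where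
  "torus_ideal q n Q = genideal (free_alg n) (torus_relations q n Q)"

definition quantum_torus ::
    "'k::field \<Rightarrow> nat \<Rightarrow> (nat \<Rightarrow> nat \<Rightarrow> int) \<Rightarrow> 'k free_elt set ring" where
  "quantum_torus q n Q = free_alg n Quot torus_ideal q n Q"

definition torus_gen ::
    "'k::field \<Rightarrow> nat \<Rightarrow> (nat \<Rightarrow> nat \<Rightarrow> int) \<Rightarrow> nat \<Rightarrow> 'k free_elt set" where
  "torus_gen q n Q i = torus_ideal q n Q +>\<^bsub>free_alg n\<^esub> letter_elt (Gen i)"

definition torus_const ::
    "'k::field \<Rightarrow> nat \<Rightarrow> (nat \<Rightarrow> nat \<Rightarrow> int) \<Rightarrow> 'k \<Rightarrow> 'k free_elt set" where
  "torus_const q n Q c = torus_ideal q n Q +>\<^bsub>free_alg n\<^esub> const_elt c"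

definition noncentral_gens ::
    "'k::field \<Rightarrow> nat \<Rightarrow> (nat \<Rightarrow> nat \<Rightarrow> int) \<Rightarrow> nat set" where
  "noncentral_gens q n Q = {i\<in>{1..n}. \<exists>j\<in>{1..n}.
     torus_gen q n Q i \<otimes>\<^bsub>quantum_torus q n Q\<^esub> torus_gen q n Q j
       \<noteq> torus_gen q n Q j \<otimes>\<^bsub>quantum_torus q n Q\<^esub> torus_gen q n Q i}"

text \<open>
  Laurent polynomials are finitely supported coefficient functions on integer exponent
  vectors. The ring \<open>laurent k\<close> is \<open>K[y\<^sub>1\<^sup>\<plusminus>\<^sup>1, \<dots>, y\<^sub>k\<^sub>-\<^sub>1\<^sup>\<plusminus>\<^sup>1]\<close>.
\<close>

type_synonym 'k laurent_elt = "(nat \<Rightarrow>\<^sub>0 int) \<Rightarrow>\<^sub>0 'k"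

definition laurent :: "nat \<Rightarrow> ('k::field) laurent_elt ring" where
  "laurent k =
    ring_on {f. \<forall>\<alpha>\<in>Poly_Mapping.keys f. Poly_Mapping.keys \<alpha> \<subseteq> {1..<k}}"

definition laurent_var :: "nat \<Rightarrow> ('k::field) laurent_elt" where
  "laurent_var i = Poly_Mapping.single (Poly_Mapping.single i 1) 1"

definition laurent_const :: "'k::field \<Rightarrow> 'k laurent_elt" where
  "laurent_const c = Poly_Mapping.single 0 c"

text \<open>
  The substitution \<open>f(y\<^sub>1, y\<^sub>2, \<dots>) \<mapsto> f(c\<^sub>1 y\<^sub>1, c\<^sub>2 y\<^sub>2, \<dots>)\<close> for nonzero \<open>c\<^sub>j\<close>: it multiplies the
  coefficient of \<open>y\<^bsup>\<alpha>\<^esup>\<close> by \<open>c\<^bsup>\<alpha>\<^esup>\<close>.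
\<close>

definition laurent_rescale :: "(nat \<Rightarrow> 'k::field) \<Rightarrow> 'k laurent_elt \<Rightarrow> 'k laurent_elt" where
  "laurent_rescale c f = Poly_Mapping.mapp
     (\<lambda>\<alpha> a. a * (\<Prod>j\<in>Poly_Mapping.keys \<alpha>. c j powi Poly_Mapping.lookup \<alpha> j)) f"

text \<open>The library locale \<^locale>\<open>module\<close> requires a commutative ring of scalars.\<close>

locale left_module = R?: ring R + M?: abelian_group M
  for R (structure) and M (structure) +
  fixes act :: "'a \<Rightarrow> 'c \<Rightarrow> 'c"
  assumes act_closed:
      "\<lbrakk>a \<in> carrier R; x \<in> carrier M\<rbrakk> \<Longrightarrow> act a x \<in> carrier M"
    and act_l_distr:
      "\<lbrakk>a \<in> carrier R; b \<in> carrier R; x \<in> carrier M\<rbrakk> \<Longrightarrow>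
        act (a \<oplus>\<^bsub>R\<^esub> b) x = act a x \<oplus>\<^bsub>M\<^esub> act b x"
    and act_r_distr:
      "\<lbrakk>a \<in> carrier R; x \<in> carrier M; y \<in> carrier M\<rbrakk> \<Longrightarrow>
        act a (x \<oplus>\<^bsub>M\<^esub> y) = act a x \<oplus>\<^bsub>M\<^esub> act a y"
    and act_assoc:
      "\<lbrakk>a \<in> carrier R; b \<in> carrier R; x \<in> carrier M\<rbrakk> \<Longrightarrow>
        act (a \<otimes>\<^bsub>R\<^esub> b) x = act a (act b x)"
    and act_one:
      "x \<in> carrier M \<Longrightarrow> act \<one>\<^bsub>R\<^esub> x = x"

text \<open>
  A module structure over the \<open>K\<close>-algebra \<open>quantum_torus q n Q\<close> on the \<open>K\<close>-vector space
  \<open>laurent k\<close>: scalars of \<open>K\<close> act by ordinary scalar multiplication. The extensionality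
  conditions fix the irrelevant values outside the carriers, so that structures can be
  compared by equality.
\<close>

definition torus_module_structure ::
    "'k::field \<Rightarrow> nat \<Rightarrow> (nat \<Rightarrow> nat \<Rightarrow> int) \<Rightarrow> nat \<Rightarrow>
      ('k free_elt set \<Rightarrow> 'k laurent_elt \<Rightarrow> 'k laurent_elt) \<Rightarrow> bool" where
  "torus_module_structure q n Q k act \<longleftrightarrow>
     left_module (quantum_torus q n Q) (laurent k) act \<and>
     (\<forall>c. \<forall>f\<in>carrier (laurent k). act (torus_const q n Q c) f = laurent_const c * f) \<and>
     act \<in> extensional (carrier (quantum_torus q n Q)) \<and>
     (\<forall>a\<in>carrier (quantum_torus q n Q). act a \<in> extensional (carrier (laurent k)))"

definition field_embedding :: "('k::field \<Rightarrow> 'l::field) \<Rightarrow> bool" where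
  "field_embedding \<iota> \<longleftrightarrow> \<iota> 1 = 1 \<and> (\<forall>x y. \<iota> (x + y) = \<iota> x + \<iota> y) \<and> (\<forall>x y. \<iota> (x * y) = \<iota> x * \<iota> y)"

text \<open>
  For a square root \<open>s\<close> of \<open>q\<close> in an extension \<open>\<iota>\<close> of \<open>K\<close>, the element \<open>q\<^bsup>a/2\<^esup> = s\<^bsup>a\<^esup>\<close> regarded
  as an element of \<open>K\<close>; meaningful only if \<open>s\<^bsup>a\<^esup>\<close> lies in the image of \<open>\<iota>\<close>.
\<close>

definition half_power :: "('k::field \<Rightarrow> 'l::field) \<Rightarrow> 'l \<Rightarrow> int \<Rightarrow> 'k" where
  "half_power \<iota> s a = inv_into UNIV \<iota> (s powi a)"

end

theory Submission
  imports Defs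
begin

text \<open>
  On Laurent polynomials consider the monomial operators
  \<open>f \<mapsto> y\<^sup>\<beta> f(c\<^sub>1 y\<^sub>1, c\<^sub>2 y\<^sub>2, \<dots>)\<close> with nonzero \<open>c\<^sub>j\<close>. They are invertible, and the rescaling
  being multiplicative, two of them, given by \<open>(\<beta>, c)\<close> and \<open>(\<gamma>, d)\<close>, commute up to the scalar
  \<open>c\<^sup>\<gamma> / d\<^sup>\<beta>\<close> (\<open>monomial_op_q_commute\<close>). So one obtains a module over the quantum torus as soon as
  each generator \<open>x\<^sub>i\<close> is given a pair \<open>(\<beta>\<^sub>i, c\<^sub>i)\<close> such that the scalar of \<open>x\<^sub>i\<close> and \<open>x\<^sub>j\<close> is
  \<open>q\<^bsup>Q i j\<^esup>\<close>.

  For the operators in question the scalar of two generators that multiply by variables is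
  \<open>q\<^bsup>Q i j / 2\<^esup> / q\<^bsup>Q j i / 2\<^esup>\<close>, which is \<open>q\<^bsup>Q i j\<^esup>\<close> by skew-symmetry. The last noncentral
  generator multiplies by no variable, so its full exponent has to come from its own rescaling,
  whence \<open>q\<^bsup>Q k j\<^esup>\<close> without the square root. A central generator acts trivially, which requires
  \<open>q\<^bsup>Q i j\<^esup> = 1\<close> whenever \<open>x\<^sub>i\<close> is central. This is the delicate point, since the quantum torus
  is given by a presentation and could a priori collapse. But a zero ring has no noncentral
  generators, and so \<open>k \<ge> 1\<close> excludes the collapse; in a nonzero ring the relation
  \<open>(q\<^bsup>Q i j\<^esup> - 1) x\<^sub>j x\<^sub>i = 0\<close> with units \<open>x\<^sub>i\<close> and \<open>x\<^sub>j\<close> forces the scalar to vanish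
  (\<open>central_imp_power_eq_1\<close>).

  An assignment of operators to the letters extends to the free algebra by evaluation of
  noncommutative polynomials, and the evaluation descends to the quotient because the elements
  that act as zero form an ideal containing the relations (\<open>free_act_torus_ideal\<close>). The
  structure is determined by the generators: constants act as scalars, and \<open>x\<^sub>i\<^sup>-\<^sup>1\<close> has to act
  as the inverse of \<open>x\<^sub>i\<close> (\<open>torus_module_structure_unique\<close>). The argument is run for an
  arbitrary enumeration of the noncentral generators, so that it gives the module structure
  whichever generators are central, and the displayed formulas when the enumeration is the
  identity.
\<close>

section \<open>Polynomials and subrings\<close>

text \<open>
  Bilinear identities between convolution products and support conditions reduce to monomials by
  this rule; \<open>w\<close> is kept in the support of \<open>p\<close> so that membership in a subalgebra defined by a
  support condition passes to the monomials.
\<close>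

lemma poly_mapping_single_induct [case_names zero single add]:
  fixes p :: "'a \<Rightarrow>\<^sub>0 'b::comm_monoid_add"
  assumes zero: "P 0"
    and single: "\<And>w c. w \<in> Poly_Mapping.keys p \<Longrightarrow> P (Poly_Mapping.single w c)"
    and add: "\<And>f g. P f \<Longrightarrow> P g \<Longrightarrow> P (f + g)"
  shows "P p"
proof -
  have "P (\<Sum>w\<in>A. Poly_Mapping.single w (Poly_Mapping.lookup p w))"
    if "finite A" "A \<subseteq> Poly_Mapping.keys p" for A
    using that by (induction A rule: finite_induct) (auto intro: zero single add)
  moreover have "(\<Sum>w\<in>Poly_Mapping.keys p. Poly_Mapping.single w (Poly_Mapping.lookup p w)) = p"
    by (rule poly_mapping_eqI)
      (auto simp: lookup_sum lookup_single when_def in_keys_iff sum.delta')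
  ultimately show ?thesis
    by (metis finite_keys order_refl)
qed

lemma ring_ring_on:
  fixes A :: "'a::ring_1 set"
  assumes "0 \<in> A" "1 \<in> A"
    and "\<And>a b. a \<in> A \<Longrightarrow> b \<in> A \<Longrightarrow> a + b \<in> A"
    and "\<And>a b. a \<in> A \<Longrightarrow> b \<in> A \<Longrightarrow> a * b \<in> A"
    and "\<And>a. a \<in> A \<Longrightarrow> - a \<in> A"
  shows "ring (ring_on A)"
  using assms unfolding ring_on_def
  by (intro ringI abelian_groupI monoidI)
    (auto simp: algebra_simps intro: bexI[of _ "- x" for x])

lemma a_minus_ring_on:
  assumes "ring (ring_on A)" "a \<in> A" "b \<in> A" "- b \<in> A"
  shows "a \<ominus>\<^bsub>ring_on A\<^esub> b = a - b"
proof -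
  interpret ring "ring_on A" by fact
  have "\<ominus>\<^bsub>ring_on A\<^esub> b = - b"
    by (rule minus_equality) (use assms in \<open>auto simp: ring_on_def\<close>)
  then show ?thesis by (simp add: a_minus_def) (simp add: ring_on_def)
qed

section \<open>The quantum torus as a quotient of the free algebra\<close>

definition letters_upto :: "nat \<Rightarrow> letter set" where
  "letters_upto n = Gen ` {1..n} \<union> Inv ` {1..n}"

lemma carrier_free_alg:
  "carrier (free_alg n) = {p. \<forall>w\<in>Poly_Mapping.keys p. set (letters w) \<subseteq> letters_upto n}"
  by (simp add: free_alg_def ring_on_def letters_upto_def)

lemma free_alg_simps [simp]:
  "a \<otimes>\<^bsub>free_alg n\<^esub> b = a * b" "a \<oplus>\<^bsub>free_alg n\<^esub> b = a + b"
  "\<one>\<^bsub>free_alg n\<^esub> = 1" "\<zero>\<^bsub>free_alg n\<^esub> = 0"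
  by (simp_all add: free_alg_def ring_on_def)

lemma zero_in_free_alg [simp]: "0 \<in> carrier (free_alg n)"
  by (simp add: carrier_free_alg)

lemma uminus_in_free_alg: "a \<in> carrier (free_alg n) \<Longrightarrow> - a \<in> carrier (free_alg n)"
  by (simp add: carrier_free_alg)

lemma ring_free_alg: "ring (free_alg n :: 'k::field free_elt ring)"
proof -
  have "free_alg n = ring_on (carrier (free_alg n :: 'k free_elt ring))"
    by (simp add: free_alg_def ring_on_def)
  moreover have "ring (ring_on (carrier (free_alg n :: 'k free_elt ring)))"
  proof (rule ring_ring_on)
    fix a b :: "'k free_elt"
    assume a: "a \<in> carrier (free_alg n)" and b: "b \<in> carrier (free_alg n)"
    show "a + b \<in> carrier (free_alg n)"
      using a b Poly_Mapping.keys_add[of a b] by (auto simp: carrier_free_alg)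
    show "a * b \<in> carrier (free_alg n)"
      using a b keys_mult[of a b] by (fastforce simp: carrier_free_alg plus_word_def)
  qed (auto simp: carrier_free_alg zero_word_def)
  ultimately show ?thesis by simp
qed

lemma free_alg_minus:
  assumes "a \<in> carrier (free_alg n)" "b \<in> carrier (free_alg n)"
  shows "a \<ominus>\<^bsub>free_alg n\<^esub> b = a - b"
proof -
  have *: "free_alg n = ring_on (carrier (free_alg n))"
    by (simp add: free_alg_def ring_on_def)
  show ?thesis
    by (subst *, rule a_minus_ring_on)
      (use * ring_free_alg uminus_in_free_alg assms in \<open>auto simp flip: *\<close>)
qed

lemma letter_elt_in_free_alg: "l \<in> letters_upto n \<Longrightarrow> letter_elt l \<in> carrier (free_alg n)"
  by (simp add: letter_elt_def carrier_free_alg)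

lemma const_elt_in_free_alg: "const_elt c \<in> carrier (free_alg n)"
  by (simp add: const_elt_def carrier_free_alg zero_word_def)

lemma single_in_free_alg:
  "set (letters w) \<subseteq> letters_upto n \<Longrightarrow> Poly_Mapping.single w c \<in> carrier (free_alg n)"
  by (simp add: carrier_free_alg)

lemma single_Word_Cons:
  "Poly_Mapping.single (Word (l # ls)) c = letter_elt l * Poly_Mapping.single (Word ls) c"
  by (simp add: letter_elt_def mult_single plus_word_def)

lemma letter_in_letters_upto [simp]:
  "i \<in> {1..n} \<Longrightarrow> Gen i \<in> letters_upto n" "i \<in> {1..n} \<Longrightarrow> Inv i \<in> letters_upto n"
  by (auto simp: letters_upto_def)

lemma minus_in_free_alg:
  assumes "a \<in> carrier (free_alg n)" "b \<in> carrier (free_alg n)"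
  shows "a - b \<in> carrier (free_alg n)"
  using assms Poly_Mapping.keys_diff[of a b] by (auto simp: carrier_free_alg)

lemma mult_in_free_alg:
  assumes "a \<in> carrier (free_alg n)" "b \<in> carrier (free_alg n)"
  shows "a * b \<in> carrier (free_alg n)"
  using ring.ring_simprules(5)[OF ring_free_alg assms] by simp

lemma add_in_free_alg:
  assumes "a \<in> carrier (free_alg n)" "b \<in> carrier (free_alg n)"
  shows "a + b \<in> carrier (free_alg n)"
  using ring.ring_simprules(1)[OF ring_free_alg assms] by simp

lemma one_in_free_alg [simp]: "1 \<in> carrier (free_alg n)"
  using ring.ring_simprules(6)[OF ring_free_alg] by simp

lemmas free_alg_closed =
  minus_in_free_alg mult_in_free_alg add_in_free_alg uminus_in_free_alg
  letter_elt_in_free_alg const_elt_in_free_alg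

lemma torus_relations_in_free_alg: "torus_relations q n Q \<subseteq> carrier (free_alg n)"
  unfolding torus_relations_def
  by (auto intro!: free_alg_closed)

lemma ideal_torus_ideal: "ideal (torus_ideal q n Q) (free_alg n)"
  unfolding torus_ideal_def
  by (rule ring.genideal_ideal[OF ring_free_alg torus_relations_in_free_alg])

lemma torus_relations_in_ideal: "torus_relations q n Q \<subseteq> torus_ideal q n Q"
  unfolding torus_ideal_def
  by (rule ring.genideal_self[OF ring_free_alg torus_relations_in_free_alg])

text \<open>
  The quotient homomorphism: the given cosets of generators and constants are values of it, and
  so are the inverses of the generators, which have no name of their own.
\<close>

definition torus_class ::
    "'k::field \<Rightarrow> nat \<Rightarrow> (nat \<Rightarrow> nat \<Rightarrow> int) \<Rightarrow> 'k free_elt \<Rightarrow> 'k free_elt set" where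
  "torus_class q n Q p = torus_ideal q n Q +>\<^bsub>free_alg n\<^esub> p"

lemma torus_gen_eq_class: "torus_gen q n Q i = torus_class q n Q (letter_elt (Gen i))"
  by (simp add: torus_gen_def torus_class_def)

lemma torus_const_eq_class: "torus_const q n Q c = torus_class q n Q (const_elt c)"
  by (simp add: torus_const_def torus_class_def)

lemma torus_class_hom: "torus_class q n Q \<in> ring_hom (free_alg n) (quantum_torus q n Q)"
  unfolding quantum_torus_def torus_class_def
  by (rule ideal.rcos_ring_hom[OF ideal_torus_ideal])

lemma torus_class_in_carrier:
  "p \<in> carrier (free_alg n) \<Longrightarrow> torus_class q n Q p \<in> carrier (quantum_torus q n Q)"
  using torus_class_hom ring_hom_closed by metis

lemma torus_class_mult:
  "a \<in> carrier (free_alg n) \<Longrightarrow> b \<in> carrier (free_alg n) \<Longrightarrow>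
    torus_class q n Q (a * b) = torus_class q n Q a \<otimes>\<^bsub>quantum_torus q n Q\<^esub> torus_class q n Q b"
  using ring_hom_mult[OF torus_class_hom] by simp

lemma torus_class_add:
  "a \<in> carrier (free_alg n) \<Longrightarrow> b \<in> carrier (free_alg n) \<Longrightarrow>
    torus_class q n Q (a + b) = torus_class q n Q a \<oplus>\<^bsub>quantum_torus q n Q\<^esub> torus_class q n Q b"
  using ring_hom_add[OF torus_class_hom] by simp

lemma torus_class_one: "torus_class q n Q 1 = \<one>\<^bsub>quantum_torus q n Q\<^esub>"
  using ring_hom_one[OF torus_class_hom] by simp

lemma torus_class_surj:
  assumes "A \<in> carrier (quantum_torus q n Q)"
  obtains p where "p \<in> carrier (free_alg n)" "A = torus_class q n Q p"
  using assms unfolding quantum_torus_def FactRing_simps torus_class_def by auto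

lemma torus_class_eq_iff:
  assumes "a \<in> carrier (free_alg n)" "b \<in> carrier (free_alg n)"
  shows "torus_class q n Q a = torus_class q n Q b \<longleftrightarrow> a - b \<in> torus_ideal q n Q"
  using ring.quotient_eq_iff_same_a_r_cos[OF ring_free_alg ideal_torus_ideal assms]
  by (simp add: torus_class_def free_alg_minus[OF assms])

lemma torus_class_relations:
  assumes "i \<in> {1..n}"
  shows "torus_class q n Q (letter_elt (Gen i) * letter_elt (Inv i)) = torus_class q n Q 1"
    and "torus_class q n Q (letter_elt (Inv i) * letter_elt (Gen i)) = torus_class q n Q 1"
    and "j \<in> {1..n} \<Longrightarrow> torus_class q n Q (letter_elt (Gen i) * letter_elt (Gen j)) =
      torus_class q n Q (const_elt (q powi Q i j) * (letter_elt (Gen j) * letter_elt (Gen i)))"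
  using assms
  by (simp_all add: torus_class_eq_iff free_alg_closed)
    (rule subsetD[OF torus_relations_in_ideal], force simp: torus_relations_def)+

lemma ring_quantum_torus: "ring (quantum_torus q n Q)"
  unfolding quantum_torus_def by (rule ideal.quotient_is_ring[OF ideal_torus_ideal])

lemma const_elt_mult: "const_elt a * const_elt b = const_elt (a * b)"
  by (simp add: const_elt_def mult_single)

lemma const_elt_diff: "const_elt a - const_elt b = const_elt (a - b)"
  by (simp add: const_elt_def single_diff)

lemma const_elt_one [simp]: "const_elt 1 = 1"
  by (simp add: const_elt_def)

section \<open>Scalars of central generators\<close>

lemma torus_trivial_imp_commutative:
  assumes "1 \<in> torus_ideal q n Q"
  shows "noncentral_gens q n Q = {}"
proof -
  have "torus_ideal q n Q = carrier (free_alg n)"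
    using ideal.one_imp_carrier[OF ideal_torus_ideal] assms by simp
  then show ?thesis
    by (auto simp: noncentral_gens_def torus_gen_eq_class torus_class_eq_iff free_alg_closed
        simp flip: torus_class_mult)
qed

text \<open>
  If \<open>c = q\<^bsup>Q i j\<^esup>\<close> differed from \<open>1\<close>, dividing \<open>(c - 1) x\<^sub>j x\<^sub>i = 0\<close> by the scalar and then
  by the units \<open>x\<^sub>i\<close> and \<open>x\<^sub>j\<close> would yield \<open>1 = 0\<close>, and there are no noncentral generators in
  the zero ring.
\<close>

lemma central_imp_power_eq_1:
  assumes ne: "noncentral_gens q n Q \<noteq> {}"
    and i: "i \<in> {1..n}" "i \<notin> noncentral_gens q n Q" and j: "j \<in> {1..n}"
  shows "q powi Q i j = 1"
proof (rule ccontr)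
  define c where "c = q powi Q i j"
  assume "q powi Q i j \<noteq> 1"
  then have c: "c - 1 \<noteq> 0" by (simp add: c_def)
  interpret I: ideal "torus_ideal q n Q" "free_alg n" by (rule ideal_torus_ideal)
  let ?gi = "letter_elt (Gen i) :: 'a free_elt" and ?gj = "letter_elt (Gen j) :: 'a free_elt"
  have closed [simp]: "?gi \<in> carrier (free_alg n)" "?gj \<in> carrier (free_alg n)"
    using i j by (auto intro: free_alg_closed)
  let ?T = "quantum_torus q n Q" and ?\<pi> = "torus_class q n Q"
  interpret T: ring ?T by (rule ring_quantum_torus)
  have "?\<pi> (?gi * ?gj) = ?\<pi> (?gj * ?gi)"
    using i j by (auto simp: noncentral_gens_def torus_gen_eq_class torus_class_mult)
  then have "?\<pi> (const_elt c * (?gj * ?gi)) = ?\<pi> (?gj * ?gi)"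
    using torus_class_relations(3)[of i n j q Q] i j by (simp add: c_def)
  then have "const_elt c * (?gj * ?gi) - ?gj * ?gi \<in> torus_ideal q n Q"
    by (subst (asm) torus_class_eq_iff) (simp_all add: free_alg_closed)
  also have "const_elt c * (?gj * ?gi) - ?gj * ?gi = const_elt (c - 1) * (?gj * ?gi)"
    by (simp add: algebra_simps flip: const_elt_diff)
  finally have "const_elt (1 / (c - 1)) * (const_elt (c - 1) * (?gj * ?gi)) \<in> torus_ideal q n Q"
    using I.I_l_closed[OF _ const_elt_in_free_alg] by (metis free_alg_simps(1))
  then have "?gj * ?gi \<in> torus_ideal q n Q"
    using c by (simp add: const_elt_mult flip: mult.assoc)
  then have "?\<pi> (?gj * ?gi) = ?\<pi> 0"
    by (subst torus_class_eq_iff) (simp_all add: free_alg_closed)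
  also have pi0: "?\<pi> 0 = \<zero>\<^bsub>?T\<^esub>"
    using ring_hom_zero[OF torus_class_hom ring_free_alg ring_quantum_torus] by simp
  finally have zero: "?\<pi> ?gj \<otimes>\<^bsub>?T\<^esub> ?\<pi> ?gi = \<zero>\<^bsub>?T\<^esub>"
    by (simp add: torus_class_mult)
  let ?vi = "letter_elt (Inv i) :: 'a free_elt" and ?vj = "letter_elt (Inv j) :: 'a free_elt"
  have v: "?vi \<in> carrier (free_alg n)" "?vj \<in> carrier (free_alg n)"
    using i j by (simp_all add: letter_elt_in_free_alg)
  note in_T = closed[THEN torus_class_in_carrier] v[THEN torus_class_in_carrier]
  have unit: "?\<pi> ?gi \<otimes>\<^bsub>?T\<^esub> ?\<pi> ?vi = \<one>\<^bsub>?T\<^esub>" "?\<pi> ?gj \<otimes>\<^bsub>?T\<^esub> ?\<pi> ?vj = \<one>\<^bsub>?T\<^esub>"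
    using torus_class_relations(1)[OF i(1), of q Q] torus_class_relations(1)[OF j, of q Q] v
    by (simp_all add: torus_class_one flip: torus_class_mult)
  have "?\<pi> ?gj = (?\<pi> ?gj \<otimes>\<^bsub>?T\<^esub> ?\<pi> ?gi) \<otimes>\<^bsub>?T\<^esub> ?\<pi> ?vi"
    using in_T by (simp add: T.m_assoc unit)
  also have "\<dots> = \<zero>\<^bsub>?T\<^esub>"
    using in_T by (simp add: zero)
  finally have "\<one>\<^bsub>?T\<^esub> = \<zero>\<^bsub>?T\<^esub>"
    using unit(2) in_T by simp
  then have "?\<pi> 1 = ?\<pi> 0"
    using pi0 by (simp add: torus_class_one)
  then have "1 \<in> torus_ideal q n Q"
    using torus_class_eq_iff[of 1 n 0 q Q] by simp
  with ne show False using torus_trivial_imp_commutative by blast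
qed

section \<open>Monomial operators on Laurent polynomials\<close>

lemma carrier_laurent:
  "carrier (laurent k) = {f. \<forall>\<alpha>\<in>Poly_Mapping.keys f. Poly_Mapping.keys \<alpha> \<subseteq> {1..<k}}"
  by (simp add: laurent_def ring_on_def)

lemma laurent_simps [simp]:
  "a \<otimes>\<^bsub>laurent k\<^esub> b = a * b" "a \<oplus>\<^bsub>laurent k\<^esub> b = a + b"
  "\<one>\<^bsub>laurent k\<^esub> = 1" "\<zero>\<^bsub>laurent k\<^esub> = 0"
  by (simp_all add: laurent_def ring_on_def)

lemma laurent_closed:
  assumes "f \<in> carrier (laurent k)" "g \<in> carrier (laurent k)"
  shows "f + g \<in> carrier (laurent k)" "f * g \<in> carrier (laurent k)"
proof -
  show "f + g \<in> carrier (laurent k)"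
    using assms Poly_Mapping.keys_add[of f g] by (auto simp: carrier_laurent)
  have "Poly_Mapping.keys \<gamma> \<subseteq> {1..<k}" if \<gamma>: "\<gamma> \<in> Poly_Mapping.keys (f * g)" for \<gamma>
  proof -
    obtain \<alpha> \<beta> where "\<gamma> = \<alpha> + \<beta>" "\<alpha> \<in> Poly_Mapping.keys f" "\<beta> \<in> Poly_Mapping.keys g"
      using \<gamma> keys_mult[of f g] by blast
    with assms Poly_Mapping.keys_add[of \<alpha> \<beta>] show ?thesis
      unfolding carrier_laurent by blast
  qed
  then show "f * g \<in> carrier (laurent k)"
    by (simp add: carrier_laurent)
qed

lemma laurent_const_in_laurent: "laurent_const c \<in> carrier (laurent k)"
  by (simp add: carrier_laurent laurent_const_def)

lemma zero_in_laurent [simp]: "0 \<in> carrier (laurent k)"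
  by (simp add: carrier_laurent)

lemma single_in_laurent:
  "Poly_Mapping.keys \<alpha> \<subseteq> {1..<k} \<Longrightarrow> Poly_Mapping.single \<alpha> c \<in> carrier (laurent k)"
  by (simp add: carrier_laurent)

lemma ring_laurent: "ring (laurent k :: 'k::field laurent_elt ring)"
proof -
  have "laurent k = ring_on (carrier (laurent k :: 'k laurent_elt ring))"
    by (simp add: laurent_def ring_on_def)
  moreover have "ring (ring_on (carrier (laurent k :: 'k laurent_elt ring)))"
    by (rule ring_ring_on) (simp_all add: laurent_closed, simp_all add: carrier_laurent)
  ultimately show ?thesis by simp
qed

lemma laurent_const_add: "laurent_const (a + b) = laurent_const a + laurent_const b"
  by (simp add: laurent_const_def single_add)

lemma laurent_const_mult: "laurent_const (a * b) = laurent_const a * laurent_const b"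
  by (simp add: laurent_const_def mult_single)

lemma laurent_const_0 [simp]: "laurent_const 0 = 0"
  and laurent_const_1 [simp]: "laurent_const 1 = 1"
  by (simp_all add: laurent_const_def)

definition monomial_value :: "(nat \<Rightarrow> 'k::field) \<Rightarrow> (nat \<Rightarrow>\<^sub>0 int) \<Rightarrow> 'k" where
  "monomial_value c \<alpha> = (\<Prod>j\<in>Poly_Mapping.keys \<alpha>. c j powi Poly_Mapping.lookup \<alpha> j)"

text \<open>
  Extending the product to a common finite index set makes the values of \<open>\<alpha>\<close>, \<open>\<beta>\<close> and
  \<open>\<alpha> + \<beta>\<close> comparable, although cancellation can shrink the support of the sum.
\<close>

lemma monomial_value_superset:
  assumes "finite A" "Poly_Mapping.keys \<alpha> \<subseteq> A"
  shows "monomial_value c \<alpha> = (\<Prod>j\<in>A. c j powi Poly_Mapping.lookup \<alpha> j)"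
  unfolding monomial_value_def
  by (rule prod.mono_neutral_left) (use assms in \<open>auto simp: in_keys_iff\<close>)

lemma monomial_value_add:
  assumes "\<And>j. c j \<noteq> 0"
  shows "monomial_value c (\<alpha> + \<beta>) = monomial_value c \<alpha> * monomial_value c \<beta>"
proof -
  let ?A = "Poly_Mapping.keys \<alpha> \<union> Poly_Mapping.keys \<beta>"
  have "monomial_value c (\<alpha> + \<beta>) = (\<Prod>j\<in>?A. c j powi Poly_Mapping.lookup (\<alpha> + \<beta>) j)"
    by (rule monomial_value_superset) (use Poly_Mapping.keys_add[of \<alpha> \<beta>] in auto)
  also have "\<dots> = (\<Prod>j\<in>?A. c j powi Poly_Mapping.lookup \<alpha> j) * (\<Prod>j\<in>?A. c j powi Poly_Mapping.lookup \<beta> j)"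
    by (simp add: lookup_add power_int_add assms prod.distrib)
  also have "\<dots> = monomial_value c \<alpha> * monomial_value c \<beta>"
    by (simp flip: monomial_value_superset)
  finally show ?thesis .
qed

lemma monomial_value_0 [simp]: "monomial_value c 0 = 1"
  by (simp add: monomial_value_def)

lemma monomial_value_single [simp]: "monomial_value c (Poly_Mapping.single i 1) = c i"
  by (simp add: monomial_value_def)

lemma monomial_value_inverse:
  "monomial_value (\<lambda>j. inverse (c j)) \<alpha> = inverse (monomial_value c \<alpha>)"
  by (simp add: monomial_value_def power_int_inverse flip: prod_inversef)

lemma monomial_value_nonzero:
  assumes "\<And>j. c j \<noteq> 0"
  shows "monomial_value c \<alpha> \<noteq> 0"
  by (simp add: monomial_value_def assms)

lemma lookup_laurent_rescale:
  "Poly_Mapping.lookup (laurent_rescale c f) \<alpha> = Poly_Mapping.lookup f \<alpha> * monomial_value c \<alpha>"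
  by (simp add: laurent_rescale_def lookup_mapp monomial_value_def when_def in_keys_iff)

lemma laurent_rescale_add: "laurent_rescale c (f + g) = laurent_rescale c f + laurent_rescale c g"
  by (rule poly_mapping_eqI) (simp add: lookup_laurent_rescale lookup_add algebra_simps)

lemma laurent_rescale_zero [simp]: "laurent_rescale c 0 = 0"
  by (rule poly_mapping_eqI) (simp add: lookup_laurent_rescale)

lemma laurent_rescale_single:
  "laurent_rescale c (Poly_Mapping.single \<alpha> a) = Poly_Mapping.single \<alpha> (a * monomial_value c \<alpha>)"
  by (rule poly_mapping_eqI) (simp add: lookup_laurent_rescale lookup_single when_def)

text \<open>
  A rescaling is a ring endomorphism because \<open>\<alpha> \<mapsto> c\<^sup>\<alpha>\<close> is a character of the exponent group.
  This is where \<open>c\<close> has to be nonzero at every index: with \<open>c j = 0\<close> the character property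
  fails for \<open>y\<^sub>j y\<^sub>j\<^sup>-\<^sup>1\<close>.
\<close>

lemma laurent_rescale_mult:
  assumes "\<And>j. c j \<noteq> 0"
  shows "laurent_rescale c (f * g) = laurent_rescale c f * laurent_rescale c g"
proof (induction f rule: poly_mapping_single_induct)
  case (single \<alpha> a)
  show ?case
    by (induction g rule: poly_mapping_single_induct)
      (simp_all add: distrib_left laurent_rescale_add mult_single laurent_rescale_single
        monomial_value_add assms, simp only: mult_ac)
qed (simp_all add: distrib_right laurent_rescale_add)

lemma laurent_rescale_const [simp]: "laurent_rescale c (laurent_const a) = laurent_const a"
  by (simp add: laurent_const_def laurent_rescale_single)

lemma laurent_rescale_commute:
  "laurent_rescale c (laurent_rescale d f) = laurent_rescale d (laurent_rescale c f)"
  by (rule poly_mapping_eqI) (simp add: lookup_laurent_rescale mult_ac)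

lemma laurent_rescale_inverse:
  assumes "\<And>j. c j \<noteq> 0"
  shows "laurent_rescale c (laurent_rescale (\<lambda>j. inverse (c j)) f) = f"
  by (rule poly_mapping_eqI)
    (simp add: lookup_laurent_rescale monomial_value_inverse monomial_value_nonzero assms)

lemma laurent_rescale_in_laurent:
  "f \<in> carrier (laurent k) \<Longrightarrow> laurent_rescale c f \<in> carrier (laurent k)"
  using keys_mapp_subset by (fastforce simp: carrier_laurent laurent_rescale_def)

lemma laurent_rescale_cong:
  assumes "f \<in> carrier (laurent k)" "\<And>j. j \<in> {1..<k} \<Longrightarrow> c j = d j"
  shows "laurent_rescale c f = laurent_rescale d f"
proof -
  have "monomial_value c \<alpha> = monomial_value d \<alpha>" if "\<alpha> \<in> Poly_Mapping.keys f" for \<alpha>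
    unfolding monomial_value_def
  proof (rule prod.cong)
    fix j assume "j \<in> Poly_Mapping.keys \<alpha>"
    with that assms(1) have "j \<in> {1..<k}" unfolding carrier_laurent by blast
    then show "c j powi Poly_Mapping.lookup \<alpha> j = d j powi Poly_Mapping.lookup \<alpha> j"
      by (simp add: assms(2))
  qed simp
  then show ?thesis
    by (intro poly_mapping_eqI) (metis lookup_laurent_rescale in_keys_iff mult_zero_left)
qed

lemma laurent_rescale_trivial:
  assumes "f \<in> carrier (laurent k)" "\<And>j. j \<in> {1..<k} \<Longrightarrow> c j = 1"
  shows "laurent_rescale c f = f"
proof -
  have "laurent_rescale (\<lambda>_. 1) f = f"
    by (rule poly_mapping_eqI) (simp add: lookup_laurent_rescale monomial_value_def)
  with laurent_rescale_cong[OF assms(1), of c "\<lambda>_. 1"] assms(2) show ?thesis by simp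
qed

definition monomial_op ::
    "(nat \<Rightarrow>\<^sub>0 int) \<Rightarrow> (nat \<Rightarrow> 'k::field) \<Rightarrow> 'k laurent_elt \<Rightarrow> 'k laurent_elt" where
  "monomial_op \<beta> c f = Poly_Mapping.single \<beta> 1 * laurent_rescale c f"

definition monomial_op_inv ::
    "(nat \<Rightarrow>\<^sub>0 int) \<Rightarrow> (nat \<Rightarrow> 'k::field) \<Rightarrow> 'k laurent_elt \<Rightarrow> 'k laurent_elt" where
  "monomial_op_inv \<beta> c f =
    laurent_rescale (\<lambda>j. inverse (c j)) (Poly_Mapping.single (- \<beta>) 1 * f)"

lemma monomial_op_inverse:
  assumes "\<And>j. c j \<noteq> 0"
  shows "monomial_op \<beta> c (monomial_op_inv \<beta> c f) = f"
    and "monomial_op_inv \<beta> c (monomial_op \<beta> c f) = f"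
  using laurent_rescale_inverse[of c] laurent_rescale_inverse[of "\<lambda>j. inverse (c j)"] assms
  by (simp_all add: monomial_op_def monomial_op_inv_def mult_single flip: mult.assoc)

text \<open>
  Moving the rescaling past \<open>y\<^sup>\<gamma>\<close> costs the factor \<open>c\<^sup>\<gamma>\<close>; what remains is symmetric in the two
  operators.
\<close>

lemma monomial_op_comp:
  assumes "\<And>j. c j \<noteq> 0"
  shows "monomial_op \<beta> c (monomial_op \<gamma> d f) =
    laurent_const (monomial_value c \<gamma>) *
      (Poly_Mapping.single (\<beta> + \<gamma>) 1 * laurent_rescale c (laurent_rescale d f))"
  by (simp add: monomial_op_def laurent_rescale_mult assms laurent_rescale_single
      laurent_const_def mult_single flip: mult.assoc)

lemma monomial_op_q_commute:
  assumes "\<And>j. c j \<noteq> 0" "\<And>j. d j \<noteq> 0"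
    and "monomial_value c \<gamma> = a * monomial_value d \<beta>"
  shows "monomial_op \<beta> c (monomial_op \<gamma> d f) = laurent_const a * monomial_op \<gamma> d (monomial_op \<beta> c f)"
  by (simp add: monomial_op_comp assms laurent_const_mult add.commute[of \<beta>]
      laurent_rescale_commute[of c] mult.assoc)

section \<open>Evaluating noncommutative polynomials at operators\<close>

text \<open>
  Operators for the letters, not yet subject to any relations, make all Laurent polynomials a
  module over the free algebra. The operators act on the whole type, and a subring \<open>laurent k\<close> is
  brought in only afterwards, so that the module laws hold without membership conditions.
\<close>

locale letter_action =
  fixes L :: "letter \<Rightarrow> 'k::field laurent_elt \<Rightarrow> 'k laurent_elt"
  assumes L_add: "L l (f + g) = L l f + L l g"
    and L_const: "L l (laurent_const c * f) = laurent_const c * L l f"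
begin

definition word_act :: "letter word \<Rightarrow> 'k laurent_elt \<Rightarrow> 'k laurent_elt" where
  "word_act w = foldr L (letters w)"

definition free_act :: "'k free_elt \<Rightarrow> 'k laurent_elt \<Rightarrow> 'k laurent_elt" where
  "free_act p f =
    (\<Sum>w\<in>Poly_Mapping.keys p. laurent_const (Poly_Mapping.lookup p w) * word_act w f)"

lemma foldr_L_add: "foldr L ls (f + g) = foldr L ls f + foldr L ls g"
  by (induction ls) (simp_all add: L_add)

lemma foldr_L_const: "foldr L ls (laurent_const c * f) = laurent_const c * foldr L ls f"
  by (induction ls) (simp_all add: L_const)

lemma word_act_plus: "word_act (u + v) f = word_act u (word_act v f)"
  by (simp add: word_act_def plus_word_def)

lemma free_act_add: "free_act (p + r) f = free_act p f + free_act r f"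
  unfolding free_act_def
  by (rule setsum_keys_plus_distrib) (simp_all add: laurent_const_add distrib_right)

lemma free_act_zero [simp]: "free_act 0 f = 0"
  by (simp add: free_act_def)

lemma free_act_uminus: "free_act (- p) f = - free_act p f"
  using free_act_add[of p "- p" f] by (simp add: eq_neg_iff_add_eq_0 add.commute)

lemma free_act_diff: "free_act (p - r) f = free_act p f - free_act r f"
  using free_act_add[of p "- r" f] by (simp add: free_act_uminus)

lemma free_act_single: "free_act (Poly_Mapping.single w c) f = laurent_const c * word_act w f"
  by (simp add: free_act_def)

lemma free_act_add_right: "free_act p (f + g) = free_act p f + free_act p g"
  by (simp add: free_act_def word_act_def foldr_L_add distrib_left sum.distrib)

lemma free_act_const_right: "free_act p (laurent_const c * f) = laurent_const c * free_act p f"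
  by (simp add: free_act_def word_act_def foldr_L_const sum_distrib_left)
    (simp only: mult_ac)

lemma free_act_zero_right [simp]: "free_act p 0 = 0"
  using free_act_const_right[of p 0 0] by simp

lemma free_act_mult: "free_act (p * r) f = free_act p (free_act r f)"
proof (induction p rule: poly_mapping_single_induct)
  case (single u a)
  show ?case
    by (induction r rule: poly_mapping_single_induct)
      (simp_all add: distrib_left free_act_add free_act_add_right mult_single free_act_single
        word_act_plus laurent_const_mult, simp add: word_act_def foldr_L_const mult_ac)
qed (simp_all add: distrib_right free_act_add)

lemma free_act_letter: "free_act (letter_elt l) f = L l f"
  by (simp add: letter_elt_def free_act_single word_act_def)

lemma free_act_const: "free_act (const_elt c) f = laurent_const c * f"
  by (simp add: const_elt_def free_act_single word_act_def zero_word_def)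

lemma free_act_one [simp]: "free_act 1 f = f"
  using free_act_const[of 1 f] by simp

lemma free_act_in_laurent:
  assumes L: "\<And>l f. l \<in> letters_upto n \<Longrightarrow> f \<in> carrier (laurent k) \<Longrightarrow> L l f \<in> carrier (laurent k)"
    and "p \<in> carrier (free_alg n)" and f: "f \<in> carrier (laurent k)"
  shows "free_act p f \<in> carrier (laurent k)"
proof -
  have word: "foldr L ls f \<in> carrier (laurent k)" if "set ls \<subseteq> letters_upto n" for ls
    using that by (induction ls) (simp_all add: f L)
  show ?thesis
  proof (induction p rule: poly_mapping_single_induct)
    case (single w c)
    with assms(2) have "set (letters w) \<subseteq> letters_upto n"
      by (simp add: carrier_free_alg)
    then show ?case
      by (simp add: free_act_single word_act_def laurent_closed laurent_const_in_laurent word)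
  qed (simp_all add: free_act_add laurent_closed)
qed

end

section \<open>Descent to the quantum torus\<close>

context letter_action
begin

lemma ideal_annihilator: "ideal {p \<in> carrier (free_alg n). \<forall>f. free_act p f = 0} (free_alg n)"
proof (rule idealI)
  show "ring (free_alg n :: 'k free_elt ring)" by (rule ring_free_alg)
  then interpret ring "free_alg n :: 'k free_elt ring" .
  have "a_inv (free_alg n) p = - p" if "p \<in> carrier (free_alg n)" for p :: "'k free_elt"
    by (rule minus_equality) (use that in \<open>simp_all add: uminus_in_free_alg\<close>)
  then show "subgroup {p \<in> carrier (free_alg n). \<forall>f. free_act p f = 0} (add_monoid (free_alg n))"
    by (intro add.subgroupI)
      (simp_all add: free_act_add free_act_uminus add_in_free_alg uminus_in_free_alg subset_iff
         flip: a_inv_def, use zero_in_free_alg free_act_zero in blast)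
qed (simp_all add: free_act_mult mult_in_free_alg)

text \<open>
  The action of a coset is that of an arbitrary representative; the restrictions produce the
  prescribed values outside the carriers.
\<close>

definition torus_act ::
    "'k \<Rightarrow> nat \<Rightarrow> (nat \<Rightarrow> nat \<Rightarrow> int) \<Rightarrow> nat \<Rightarrow> 'k free_elt set \<Rightarrow> 'k laurent_elt \<Rightarrow> 'k laurent_elt" where
  "torus_act q n Q k =
    (\<lambda>A\<in>carrier (quantum_torus q n Q). \<lambda>f\<in>carrier (laurent k).
      free_act (SOME p. p \<in> carrier (free_alg n) \<and> torus_class q n Q p = A) f)"

context
  fixes q :: 'k and n k :: nat and Q :: "nat \<Rightarrow> nat \<Rightarrow> int"
  assumes inverse_right: "\<And>i f. i \<in> {1..n} \<Longrightarrow> L (Gen i) (L (Inv i) f) = f"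
    and inverse_left: "\<And>i f. i \<in> {1..n} \<Longrightarrow> L (Inv i) (L (Gen i) f) = f"
    and q_commute: "\<And>i j f. i \<in> {1..n} \<Longrightarrow> j \<in> {1..n} \<Longrightarrow>
      L (Gen i) (L (Gen j) f) = laurent_const (q powi Q i j) * L (Gen j) (L (Gen i) f)"
    and L_closed: "\<And>l f. l \<in> letters_upto n \<Longrightarrow> f \<in> carrier (laurent k) \<Longrightarrow>
      L l f \<in> carrier (laurent k)"
begin

text \<open>
  The annihilator of the module is an ideal, and it contains the defining relations, hence the
  ideal that they generate. So representatives of one coset act alike.
\<close>

lemma free_act_torus_ideal:
  assumes "p \<in> torus_ideal q n Q"
  shows "free_act p f = 0"
proof -
  have "free_act p f = 0" if "p \<in> torus_relations q n Q" for p f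
    using that unfolding torus_relations_def
    by (auto simp: free_act_diff free_act_mult free_act_letter free_act_const
        inverse_left inverse_right simp del: One_nat_def intro!: q_commute)
  then have "torus_relations q n Q \<subseteq> {p \<in> carrier (free_alg n). \<forall>f. free_act p f = 0}"
    using torus_relations_in_free_alg by blast
  from ring.genideal_minimal[OF ring_free_alg ideal_annihilator this] assms
  show ?thesis by (auto simp: torus_ideal_def)
qed

lemma torus_act_class:
  assumes p: "p \<in> carrier (free_alg n)" and f: "f \<in> carrier (laurent k)"
  shows "torus_act q n Q k (torus_class q n Q p) f = free_act p f"
proof -
  define r where
    "r = (SOME r. r \<in> carrier (free_alg n) \<and> torus_class q n Q r = torus_class q n Q p)"
  have r: "r \<in> carrier (free_alg n)" "torus_class q n Q r = torus_class q n Q p"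
    using someI[of "\<lambda>r. r \<in> carrier (free_alg n) \<and> torus_class q n Q r = torus_class q n Q p" p] p
    by (simp_all add: r_def)
  have "r - p \<in> torus_ideal q n Q"
    using r p torus_class_eq_iff by blast
  then have "free_act r f = free_act p f"
    using free_act_torus_ideal[of "r - p" f] by (simp add: free_act_diff)
  moreover have "torus_act q n Q k (torus_class q n Q p) f = free_act r f"
    using p f by (simp add: torus_act_def torus_class_in_carrier flip: r_def)
  ultimately show ?thesis by simp
qed

lemma torus_module_structure_torus_act: "torus_module_structure q n Q k (torus_act q n Q k)"
  unfolding torus_module_structure_def
proof (intro conjI allI ballI)
  have "left_module_axioms (quantum_torus q n Q) (laurent k) (torus_act q n Q k)"
  proof (rule left_module_axioms.intro)
    fix A B and f :: "'k laurent_elt"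
    assume "A \<in> carrier (quantum_torus q n Q)" and B: "B \<in> carrier (quantum_torus q n Q)"
    then obtain p where p: "p \<in> carrier (free_alg n)" and A: "A = torus_class q n Q p"
      by (elim torus_class_surj)
    from B obtain r where r: "r \<in> carrier (free_alg n)" and B: "B = torus_class q n Q r"
      by (rule torus_class_surj)
    note pr = p r and AB = A B
    assume f: "f \<in> carrier (laurent k)"
    show "torus_act q n Q k (A \<oplus>\<^bsub>quantum_torus q n Q\<^esub> B) f =
      torus_act q n Q k A f \<oplus>\<^bsub>laurent k\<^esub> torus_act q n Q k B f"
      using pr f unfolding AB
      by (simp add: torus_act_class free_act_add add_in_free_alg flip: torus_class_add)
    show "torus_act q n Q k (A \<otimes>\<^bsub>quantum_torus q n Q\<^esub> B) f =
      torus_act q n Q k A (torus_act q n Q k B f)"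
      using pr f unfolding AB
      by (simp add: torus_act_class free_act_mult mult_in_free_alg free_act_in_laurent[OF L_closed]
          flip: torus_class_mult)
  next
    fix A and f g :: "'k laurent_elt"
    assume "A \<in> carrier (quantum_torus q n Q)"
    then obtain p where p: "p \<in> carrier (free_alg n)" and A: "A = torus_class q n Q p"
      by (rule torus_class_surj)
    assume f: "f \<in> carrier (laurent k)"
    show "torus_act q n Q k A f \<in> carrier (laurent k)"
      using p f unfolding A by (simp add: torus_act_class free_act_in_laurent[OF L_closed])
    assume g: "g \<in> carrier (laurent k)"
    show "torus_act q n Q k A (f \<oplus>\<^bsub>laurent k\<^esub> g) =
      torus_act q n Q k A f \<oplus>\<^bsub>laurent k\<^esub> torus_act q n Q k A g"
      using p f g unfolding A by (simp add: torus_act_class free_act_add_right laurent_closed)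
  next
    fix f :: "'k laurent_elt" assume f: "f \<in> carrier (laurent k)"
    show "torus_act q n Q k \<one>\<^bsub>quantum_torus q n Q\<^esub> f = f"
      using f by (simp add: torus_act_class flip: torus_class_one)
  qed
  then show "left_module (quantum_torus q n Q) (laurent k) (torus_act q n Q k)"
    by (intro left_module.intro ring_quantum_torus ring.is_abelian_group ring_laurent)
  show "torus_act q n Q k (torus_const q n Q c) f = laurent_const c * f"
    if "f \<in> carrier (laurent k)" for c f
    using that by (simp add: torus_const_eq_class torus_act_class const_elt_in_free_alg free_act_const)
  show "torus_act q n Q k \<in> extensional (carrier (quantum_torus q n Q))"
    by (simp add: torus_act_def)
  show "torus_act q n Q k A \<in> extensional (carrier (laurent k))"
    if "A \<in> carrier (quantum_torus q n Q)" for A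
    using that by (simp add: torus_act_def)
qed

lemma torus_act_gen:
  "i \<in> {1..n} \<Longrightarrow> f \<in> carrier (laurent k) \<Longrightarrow> torus_act q n Q k (torus_gen q n Q i) f = L (Gen i) f"
  by (simp add: torus_gen_eq_class torus_act_class letter_elt_in_free_alg free_act_letter)

end

end

text \<open>
  The quantum torus is spanned by words in the \<open>x\<^sub>i\<close> and their inverses, and two actions that
  agree on \<open>x\<^sub>i\<close> agree on \<open>x\<^sub>i\<^sup>-\<^sup>1\<close>: if \<open>g\<close> is \<open>x\<^sub>i\<^sup>-\<^sup>1 f\<close> for the first,
  then \<open>f = x\<^sub>i g\<close> for both.
\<close>

lemma torus_module_structure_unique:
  assumes 1: "torus_module_structure q n Q k act1" and 2: "torus_module_structure q n Q k act2"
    and gens: "\<And>i f. i \<in> {1..n} \<Longrightarrow> f \<in> carrier (laurent k) \<Longrightarrow>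
      act1 (torus_gen q n Q i) f = act2 (torus_gen q n Q i) f"
  shows "act1 = act2"
proof -
  let ?\<pi> = "torus_class q n Q"
  interpret A1: left_module "quantum_torus q n Q" "laurent k" act1
    using 1 by (simp add: torus_module_structure_def)
  interpret A2: left_module "quantum_torus q n Q" "laurent k" act2
    using 2 by (simp add: torus_module_structure_def)
  have letter: "act1 (?\<pi> (letter_elt l)) f = act2 (?\<pi> (letter_elt l)) f"
    if l: "l \<in> letters_upto n" and f: "f \<in> carrier (laurent k)" for l f
  proof (cases l)
    case (Gen i)
    then show ?thesis
      using gens[of i f] l f by (auto simp: letters_upto_def torus_gen_eq_class)
  next
    case (Inv i)
    then have i: "i \<in> {1..n}" using l by (auto simp: letters_upto_def)
    let ?x = "?\<pi> (letter_elt (Gen i))" and ?x' = "?\<pi> (letter_elt (Inv i))"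
    have x: "?x \<in> carrier (quantum_torus q n Q)" "?x' \<in> carrier (quantum_torus q n Q)"
      using i by (simp_all add: torus_class_in_carrier letter_elt_in_free_alg)
    have unit: "?x \<otimes>\<^bsub>quantum_torus q n Q\<^esub> ?x' = \<one>\<^bsub>quantum_torus q n Q\<^esub>"
      "?x' \<otimes>\<^bsub>quantum_torus q n Q\<^esub> ?x = \<one>\<^bsub>quantum_torus q n Q\<^esub>"
      using torus_class_relations(1,2)[OF i, of q Q] i
      by (simp_all add: torus_class_one letter_elt_in_free_alg flip: torus_class_mult)
    let ?g = "act1 ?x' f"
    have g: "?g \<in> carrier (laurent k)" using x f by (rule_tac A1.act_closed)
    have "f = act1 ?x ?g"
      using A1.act_assoc[OF x f] f by (simp add: unit A1.act_one)
    also have "\<dots> = act2 ?x ?g"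
      using gens[OF i g] by (simp add: torus_gen_eq_class)
    finally have "act2 ?x' f = act2 ?x' (act2 ?x ?g)" by simp
    also have "\<dots> = ?g"
      using A2.act_assoc[OF x(2,1) g] g by (simp add: unit A2.act_one)
    finally show ?thesis by (simp add: Inv)
  qed
  have word: "act1 (?\<pi> (Poly_Mapping.single (Word ls) c)) f = act2 (?\<pi> (Poly_Mapping.single (Word ls) c)) f"
    if "set ls \<subseteq> letters_upto n" and f: "f \<in> carrier (laurent k)" for ls c f
    using that(1)
  proof (induction ls)
    case Nil
    have "act1 (torus_const q n Q c) f = act2 (torus_const q n Q c) f"
      using 1 2 f by (simp add: torus_module_structure_def)
    then show ?case by (simp add: torus_const_eq_class const_elt_def zero_word_def)
  next
    case (Cons l ls)
    then have in_free: "letter_elt l \<in> carrier (free_alg n)"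
      "Poly_Mapping.single (Word ls) c \<in> carrier (free_alg n)"
      by (simp_all add: letter_elt_in_free_alg single_in_free_alg)
    note in_T = in_free[THEN torus_class_in_carrier, where q = q and Q = Q]
    show ?case
      using Cons f in_T
      by (simp add: single_Word_Cons torus_class_mult[OF in_free] A1.act_assoc A2.act_assoc
          letter A2.act_closed)
  qed
  have free: "act1 (?\<pi> p) f = act2 (?\<pi> p) f"
    if p: "p \<in> carrier (free_alg n)" and f: "f \<in> carrier (laurent k)" for p f
  proof -
    have "p \<in> carrier (free_alg n) \<and> act1 (?\<pi> p) f = act2 (?\<pi> p) f"
    proof (induction p rule: poly_mapping_single_induct)
      case zero
      show ?case using word[of "[]" f 0] f by simp
    next
      case (single w c)
      then have "set (letters w) \<subseteq> letters_upto n"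
        using p by (auto simp: carrier_free_alg)
      then show ?case
        using word[of "letters w" f c] f by (simp add: single_in_free_alg)
    next
      case (add a b)
      then show ?case
        using f by (simp add: torus_class_add add_in_free_alg A1.act_l_distr A2.act_l_distr
            torus_class_in_carrier)
    qed
    then show ?thesis ..
  qed
  show ?thesis
  proof
    fix A
    show "act1 A = act2 A"
    proof (cases "A \<in> carrier (quantum_torus q n Q)")
      case True
      then obtain p where "p \<in> carrier (free_alg n)" "A = ?\<pi> p" by (rule torus_class_surj)
      then have eq: "act1 A f = act2 A f" if "f \<in> carrier (laurent k)" for f
        using free that by simp
      have "act1 A \<in> extensional (carrier (laurent k))" "act2 A \<in> extensional (carrier (laurent k))"
        using 1 2 True by (simp_all add: torus_module_structure_def)
      then show ?thesis by (rule extensionalityI) (rule eq)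
    next
      case False
      with 1 2 show ?thesis
        by (simp add: torus_module_structure_def extensional_def)
    qed
  qed
qed

section \<open>The module structure of an enumeration of the noncentral generators\<close>

text \<open>
  Both facts hold for \<open>s\<^sup>a\<close> in the extension, since \<open>q\<^sup>a = s\<^sup>a s\<^sup>a\<close>, and descend along the
  injective embedding. Together with skew-symmetry they are all that the operators need of the
  square root.
\<close>

lemma half_power_skew:
  assumes emb: "field_embedding \<iota>" and s: "s ^ 2 = \<iota> q" and q: "q \<noteq> 0"
    and a: "s powi a \<in> range \<iota>" and ma: "s powi (- a) \<in> range \<iota>"
  shows "half_power \<iota> s a = q powi a * half_power \<iota> s (- a)" "half_power \<iota> s a \<noteq> 0"
proof -
  have \<iota>: "\<iota> 1 = 1" "\<iota> (x + y) = \<iota> x + \<iota> y" "\<iota> (x * y) = \<iota> x * \<iota> y" for x y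
    using emb by (simp_all add: field_embedding_def)
  have "\<iota> 0 + \<iota> 0 = \<iota> 0 + 0" by (simp flip: \<iota>(2))
  then have \<iota>0: "\<iota> 0 = 0" by (simp only: add_left_cancel)
  have \<iota>_inverse: "\<iota> (inverse x) = inverse (\<iota> x)" for x
  proof (cases "x = 0")
    case False
    then have "\<iota> x * \<iota> (inverse x) = 1" by (simp add: \<iota>(1) flip: \<iota>(3))
    then show ?thesis by (simp add: inverse_unique)
  qed (simp add: \<iota>0)
  have \<iota>_power: "\<iota> (x ^ m) = \<iota> x ^ m" for x m
    by (induction m) (simp_all add: \<iota>)
  have \<iota>_powi: "\<iota> (x powi b) = \<iota> x powi b" for x b
    by (simp add: power_int_def \<iota>_power \<iota>_inverse)
  have nz: "\<iota> x \<noteq> 0" if "x \<noteq> 0" for x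
    using \<iota>(3)[of x "inverse x"] that by (auto simp: \<iota>(1))
  have inj: "inj \<iota>"
  proof (rule injI, rule ccontr)
    fix x y assume "\<iota> x = \<iota> y" "x \<noteq> y"
    moreover have "\<iota> (x - y) + \<iota> y = \<iota> x" by (simp flip: \<iota>(2))
    ultimately show False using nz[of "x - y"] by simp
  qed
  have s0: "s \<noteq> 0" using s nz[OF q] by auto
  have half: "\<iota> (half_power \<iota> s a) = s powi a" "\<iota> (half_power \<iota> s (- a)) = s powi (- a)"
    using a ma by (simp_all add: half_power_def f_inv_into_f)
  have "\<iota> (q powi a) = s powi a * s powi a"
    by (simp add: \<iota>_powi flip: s power2_eq_square power_int_power')
      (simp add: power2_eq_square power_int_mult_distrib)
  then have "\<iota> (q powi a * half_power \<iota> s (- a)) = s powi a"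
    using s0 by (simp add: \<iota>(3) half power_int_minus)
  with half(1) inj show "half_power \<iota> s a = q powi a * half_power \<iota> s (- a)"
    by (metis injD)
  show "half_power \<iota> s a \<noteq> 0" using half(1) s0 \<iota>0 by auto
qed

text \<open>
  Here \<open>h a\<close> stands for \<open>q\<^bsup>a/2\<^esup>\<close>, and \<open>p\<close> matches the indices \<open>1, \<dots>, k\<close> of variables and
  operators with the noncentral generators. The first \<open>k - 1\<close> of these multiply by a variable,
  and the last one only rescales.
\<close>

lemma torus_module_structure_of_enumeration:
  fixes q :: "'k::field"
  assumes q: "q \<noteq> 0"
    and skew: "\<And>i j. i \<in> {1..n} \<Longrightarrow> j \<in> {1..n} \<Longrightarrow> Q j i = - Q i j"
    and h: "\<And>i j. i \<in> {1..n} \<Longrightarrow> j \<in> {1..n} \<Longrightarrow> h (Q i j) = q powi Q i j * h (Q j i)"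
    and h0: "\<And>i j. i \<in> {1..n} \<Longrightarrow> j \<in> {1..n} \<Longrightarrow> h (Q i j) \<noteq> 0"
    and k: "k \<ge> 1"
    and p: "bij_betw p {1..k} (noncentral_gens q n Q)"
  shows "\<exists>act. torus_module_structure q n Q k act \<and>
    (\<forall>f\<in>carrier (laurent k).
      (\<forall>a\<in>{1..k-1}. act (torus_gen q n Q (p a)) f
         = laurent_var a * laurent_rescale (\<lambda>b. h (Q (p a) (p b))) f) \<and>
      act (torus_gen q n Q (p k)) f = laurent_rescale (\<lambda>b. q powi Q (p k) (p b)) f \<and>
      (\<forall>m\<in>{1..n} - noncentral_gens q n Q. act (torus_gen q n Q m) f = f))"
proof -
  let ?N = "noncentral_gens q n Q"
  define r where "r = inv_into {1..k} p"
  have rp [simp]: "r (p a) = a" if "a \<in> {1..k}" for a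
    using p that by (simp add: r_def bij_betw_inv_into_left)
  have pN: "p a \<in> ?N" if "a \<in> {1..k}" for a using p that by (auto simp: bij_betw_def)
  have N: "?N \<subseteq> {1..n}" by (auto simp: noncentral_gens_def)
  have pn: "p a \<in> {1..n}" if "a \<in> {1..k}" for a using pN[OF that] N by auto
  have N_cases: "\<exists>a\<in>{1..k}. i = p a" if "i \<in> ?N" for i using p that by (auto simp: bij_betw_def)
  have ne: "?N \<noteq> {}" using pN[of k] k by auto
  have central: "q powi Q i j = 1" if "i \<in> {1..n}" "j \<in> {1..n}" "i \<notin> ?N \<or> j \<notin> ?N" for i j
    using that central_imp_power_eq_1[OF ne, of i j] central_imp_power_eq_1[OF ne, of j i]
      skew[of i j] by (auto simp: power_int_minus)
  \<comment> \<open>The value of \<open>c i\<close> at indices of no variable is set to \<open>1\<close>, since \<open>h\<close> and \<open>Q\<close> are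
    uncontrolled there and rescalings are multiplicative only if all factors are nonzero.\<close>
  define \<beta> :: "nat \<Rightarrow> nat \<Rightarrow>\<^sub>0 int" where
    "\<beta> i = (if i \<in> ?N \<and> r i < k then Poly_Mapping.single (r i) 1 else 0)" for i
  define c :: "nat \<Rightarrow> nat \<Rightarrow> 'k" where
    "c i b = (if i \<in> ?N \<and> b \<in> {1..<k}
      then if r i < k then h (Q i (p b)) else q powi Q i (p b) else 1)" for i b
  have c0: "c i b \<noteq> 0" for i b
    using h0[of i "p b"] pn[of b] q N by (auto simp: c_def)
  have \<beta>_keys: "Poly_Mapping.keys (\<beta> i) \<subseteq> {1..<k}" for i
  proof -
    have "1 \<le> r i" if "i \<in> ?N" using N_cases[OF that] by auto
    then show ?thesis by (auto simp: \<beta>_def)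
  qed
  have compat: "monomial_value (c i) (\<beta> j) = q powi Q i j * monomial_value (c j) (\<beta> i)"
    if ij: "i \<in> {1..n}" "j \<in> {1..n}" for i j
  proof (cases "i \<in> ?N \<and> j \<in> ?N")
    case False
    then have "monomial_value (c i) (\<beta> j) = 1" "monomial_value (c j) (\<beta> i) = 1"
      using \<beta>_keys by (auto simp: c_def \<beta>_def)
    with central[OF ij] False show ?thesis by auto
  next
    case True
    then obtain a b where ab: "a \<in> {1..k}" "b \<in> {1..k}" and eq: "i = p a" "j = p b"
      using N_cases by meson
    \<comment> \<open>Two of the first \<open>k - 1\<close> generators share the power of \<open>q\<close> in two halves. The last one
      multiplies by no variable, so that its partner contributes \<open>1\<close> and it contributes the full
      power.\<close>
    have val: "monomial_value (c (p a)) (\<beta> (p b)) =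
        (if b < k then if a < k then h (Q (p a) (p b)) else q powi Q (p a) (p b) else 1)"
      if "a \<in> {1..k}" "b \<in> {1..k}" for a b
      using that pN by (auto simp: \<beta>_def c_def)
    have "q powi Q i j * q powi Q j i = 1"
      using skew[OF ij] q by (simp add: power_int_minus)
    moreover have "q powi Q i i = 1"
      using skew[of i i] ij by simp
    ultimately show ?thesis
      using ab h[OF ij] by (auto simp: eq val)
  qed
  define L :: "letter \<Rightarrow> 'k laurent_elt \<Rightarrow> 'k laurent_elt" where
    "L l = (case l of Gen i \<Rightarrow> monomial_op (\<beta> i) (c i) | Inv i \<Rightarrow> monomial_op_inv (\<beta> i) (c i))" for l
  interpret letter_action L
    by standard (auto simp: L_def monomial_op_def monomial_op_inv_def laurent_rescale_add
        laurent_rescale_mult c0 algebra_simps split: letter.split)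
  have L_closed: "L l f \<in> carrier (laurent k)" if "f \<in> carrier (laurent k)" for l f
    using that \<beta>_keys
    by (simp add: L_def monomial_op_def monomial_op_inv_def laurent_closed laurent_rescale_in_laurent
        single_in_laurent split: letter.split)
  have inverse: "L (Gen i) (L (Inv i) f) = f" "L (Inv i) (L (Gen i) f) = f" for i f
    by (simp_all add: L_def monomial_op_inverse c0)
  have q_commute: "L (Gen i) (L (Gen j) f) = laurent_const (q powi Q i j) * L (Gen j) (L (Gen i) f)"
    if "i \<in> {1..n}" "j \<in> {1..n}" for i j f
    by (simp add: L_def monomial_op_q_commute c0 compat[OF that])
  have gen: "torus_act q n Q k (torus_gen q n Q i) f = L (Gen i) f"
    if "i \<in> {1..n}" "f \<in> carrier (laurent k)" for i f
    by (rule torus_act_gen[OF inverse q_commute L_closed that])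
  show ?thesis
  proof (intro exI[of _ "torus_act q n Q k"] conjI ballI)
    show "torus_module_structure q n Q k (torus_act q n Q k)"
      by (rule torus_module_structure_torus_act[OF inverse q_commute L_closed])
    fix f :: "'k laurent_elt" assume f: "f \<in> carrier (laurent k)"
    show "torus_act q n Q k (torus_gen q n Q (p a)) f
        = laurent_var a * laurent_rescale (\<lambda>b. h (Q (p a) (p b))) f" if a: "a \<in> {1..k-1}" for a
    proof -
      have ak: "a \<in> {1..k}" "a < k" using a by auto
      have "laurent_rescale (c (p a)) f = laurent_rescale (\<lambda>b. h (Q (p a) (p b))) f"
        using ak pN[OF ak(1)] by (intro laurent_rescale_cong[OF f]) (simp add: c_def)
      then show ?thesis
        using ak pN[OF ak(1)]
        by (simp add: gen[OF pn[OF ak(1)] f] L_def monomial_op_def laurent_var_def \<beta>_def)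
    qed
    show "torus_act q n Q k (torus_gen q n Q (p k)) f = laurent_rescale (\<lambda>b. q powi Q (p k) (p b)) f"
      using f pn[of k] pN[of k] k by (simp add: gen L_def monomial_op_def \<beta>_def)
        (rule laurent_rescale_cong[OF f], simp add: c_def)
    show "torus_act q n Q k (torus_gen q n Q m) f = f" if "m \<in> {1..n} - ?N" for m
      using that f by (simp add: gen L_def monomial_op_def \<beta>_def)
        (rule laurent_rescale_trivial[OF f], simp add: c_def)
  qed
qed

theorem proposition4p3p1:
  fixes q :: "'k::field"
    and \<iota> :: "'k \<Rightarrow> 'l::field"
    and s :: 'l
    and Q :: "nat \<Rightarrow> nat \<Rightarrow> int"
    and n k :: nat
  assumes "q \<noteq> 0"
    and "\<forall>i\<in>{1..n}. \<forall>j\<in>{1..n}. Q j i = - Q i j"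
    and "field_embedding \<iota>"
    and "s ^ 2 = \<iota> q"
    and "\<forall>i\<in>{1..n}. \<forall>j\<in>{1..n}. s powi Q i j \<in> range \<iota>"
    and "k = card (noncentral_gens q n Q)"
    and "k \<ge> 1"
  shows "(\<exists>act. torus_module_structure q n Q k act) \<and>
    (noncentral_gens q n Q = {1..k} \<longrightarrow>
      (\<exists>!act. torus_module_structure q n Q k act \<and>
        (\<forall>f\<in>carrier (laurent k).
          (\<forall>i\<in>{1..k-1}. act (torus_gen q n Q i) f
             = laurent_var i * laurent_rescale (\<lambda>j. half_power \<iota> s (Q i j)) f) \<and>
          act (torus_gen q n Q k) f = laurent_rescale (\<lambda>j. q powi Q k j) f \<and>
          (\<forall>m\<in>{k+1..n}. act (torus_gen q n Q m) f = f))))"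
proof -
  let ?N = "noncentral_gens q n Q" and ?h = "half_power \<iota> s"
  have skew: "Q j i = - Q i j" if "i \<in> {1..n}" "j \<in> {1..n}" for i j
    using assms(2) that by blast
  have h: "?h (Q i j) = q powi Q i j * ?h (Q j i)" "?h (Q i j) \<noteq> 0"
    if "i \<in> {1..n}" "j \<in> {1..n}" for i j
    using half_power_skew[OF assms(3,4,1), of "Q i j"] assms(5) that skew[OF that] by (metis, metis)
  note enum = torus_module_structure_of_enumeration[of q n Q ?h k, OF assms(1) skew h assms(7)]
  have fin: "finite ?N" by (simp add: noncentral_gens_def)
  obtain p where p: "bij_betw p {1..k} ?N"
    using ex_bij_betw_nat_finite_1[OF fin] assms(6) by auto
  have "\<exists>act. torus_module_structure q n Q k act"
    using enum[OF _ _ _ _ _ _ p] by auto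
  moreover have "\<exists>!act. torus_module_structure q n Q k act \<and>
        (\<forall>f\<in>carrier (laurent k).
          (\<forall>i\<in>{1..k-1}. act (torus_gen q n Q i) f
             = laurent_var i * laurent_rescale (\<lambda>j. ?h (Q i j)) f) \<and>
          act (torus_gen q n Q k) f = laurent_rescale (\<lambda>j. q powi Q k j) f \<and>
          (\<forall>m\<in>{k+1..n}. act (torus_gen q n Q m) f = f))" (is "\<exists>!act. ?P act")
    if N: "?N = {1..k}"
  proof (rule ex_ex1I)
    have "bij_betw (\<lambda>a. a) {1..k} ?N" by (simp add: N bij_betw_def)
    moreover have "{1..n} - ?N = {k+1..n}" by (auto simp: N)
    ultimately show "\<exists>act. ?P act"
      using enum[of "\<lambda>a. a"] by simp
    fix act1 act2 assume 1: "?P act1" and 2: "?P act2"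
    show "act1 = act2"
    proof (rule torus_module_structure_unique)
      fix i and f :: "'k laurent_elt"
      assume i: "i \<in> {1..n}" and f: "f \<in> carrier (laurent k)"
      from i consider "i \<in> {1..k-1}" | "i = k" | "i \<in> {k+1..n}" by fastforce
      then show "act1 (torus_gen q n Q i) f = act2 (torus_gen q n Q i) f"
        using 1 2 f by cases simp_all
    qed (use 1 2 in auto)
  qed
  ultimately show ?thesis by blast
qed

end
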